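(* Let $n$ be a positive integer and let $T_1,T_2$ be $\mathbb{C}_1$-linear operators on $\mathbb{C}_1^n$. The linear operator $T = e_1T_1+e_2T_2 \in L_1^{n}\times_e L_1^{n}$ is $\mathbb{C}_2$-idempotent if and only if $T_1$ and $T_2$ are idempotent linear operators.
   Context: $\mathbb{C}_1$ is the field of complex numbers (imaginary unit $i_1$). The bicomplex numbers are $\mathbb{C}_2 = \{z_1 + i_2 z_2 : z_1,z_2\in\mathbb{C}_1\}$, a commutative ring with $i_1^2=i_2^2=-1$ and $i_1 i_2 = i_2 i_1$. Put $e_1 = (1+i_1 i_2)/2$ and $e_2 = (1-i_1 i_2)/2$; these satisfy $e_1^2=e_1$, $e_2^2=e_2$, $e_1e_2=0$, $e_1+e_2=1$. Every $\xi = z_1+i_2 z_2\in\mathbb{C}_2$ is written uniquely as $\xi = \xi^- e_1 + \xi^+ e_2$ with $\xi^- = z_1 - i_1 z_2$ and $\xi^+ = z_1 + i_1 z_2$ in $\mathbb{C}_1$. For $\mathbb{C}_1$-linear operators $T_1,T_2$ on $\mathbb{C}_1^n$, the $\mathbb{C}_1$-linear operator $e_1T_1+e_2T_2:\mathbb{C}_2^n\to\mathbb{C}_2^n$ is defined by $$(e_1T_1+e_2T_2)(\xi_1,\dots,\xi_n) = e_1\cdot T_1(\xi_1^-,\dots,\xi_n^-) + e_2\cdot T_2(\xi_1^+,\dots,\xi_n^+).$$ The set of all such operators is denoted $L_1^n\times_e L_1^n$. An operator $T\in L_1^n\times_e L_1^n$ is called $\mathbb{C}_2$-idempotent if $T^2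 = T\circ T = T$. *)

theory Defs
  imports "HOL-Analysis.Analysis"
begin

(* The bicomplex number z1 + i_2 z2 is represented by its two complex components,
   in the same style as type complex in the library. *)
codatatype bicomplex = Bicomplex (bc1: complex) (bc2: complex)

lemma bicomplex_eqI: "bc1 x = bc1 y \<Longrightarrow> bc2 x = bc2 y \<Longrightarrow> x = y"
  by (rule bicomplex.expand) simp

lemma bicomplex_eq_iff: "x = y \<longleftrightarrow> bc1 x = bc1 y \<and> bc2 x = bc2 y"
  by (auto intro: bicomplex_eqI)

instantiation bicomplex :: comm_ring_1
begin

primcorec zero_bicomplex where
  "bc1 0 = 0"
| "bc2 0 = 0"

primcorec one_bicomplex where
  "bc1 1 = 1"
| "bc2 1 = 0"

primcorec plus_bicomplex where
  "bc1 (x + y) = bc1 x + bc1 y"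
| "bc2 (x + y) = bc2 x + bc2 y"

primcorec uminus_bicomplex where
  "bc1 (- x) = - bc1 x"
| "bc2 (- x) = - bc2 x"

primcorec minus_bicomplex where
  "bc1 (x - y) = bc1 x - bc1 y"
| "bc2 (x - y) = bc2 x - bc2 y"

primcorec times_bicomplex where
  "bc1 (x * y) = bc1 x * bc1 y - bc2 x * bc2 y"
| "bc2 (x * y) = bc1 x * bc2 y + bc2 x * bc1 y"

instance
  by standard (simp_all add: bicomplex_eq_iff algebra_simps)

end

definition bc_of_complex :: "complex \<Rightarrow> bicomplex" where
  "bc_of_complex z = Bicomplex z 0"

definition bc_i1 :: bicomplex where
  "bc_i1 = bc_of_complex \<i>"

definition bc_i2 :: bicomplex where
  "bc_i2 = Bicomplex 0 1"

lemma bicomplex_decomp: "Bicomplex z1 z2 = bc_of_complex z1 + bc_i2 * bc_of_complex z2"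
  by (simp add: bicomplex_eq_iff bc_of_complex_def bc_i2_def)

lemma bc_i1_square: "bc_i1 * bc_i1 = -1"
  by (simp add: bicomplex_eq_iff bc_of_complex_def bc_i1_def)

lemma bc_i2_square: "bc_i2 * bc_i2 = -1"
  by (simp add: bicomplex_eq_iff bc_i2_def)

(* There is no division on bicomplex, so halving is multiplication by the scalar 1/2. *)
definition bc_e1 :: bicomplex where
  "bc_e1 = bc_of_complex (1/2) * (1 + bc_i1 * bc_i2)"

definition bc_e2 :: bicomplex where
  "bc_e2 = bc_of_complex (1/2) * (1 - bc_i1 * bc_i2)"

definition bc_minus :: "bicomplex \<Rightarrow> complex" where
  "bc_minus x = bc1 x - \<i> * bc2 x"

definition bc_plus :: "bicomplex \<Rightarrow> complex" where
  "bc_plus x = bc1 x + \<i> * bc2 x"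

lemma bc_idempotent_decomp:
  "x = bc_of_complex (bc_minus x) * bc_e1 + bc_of_complex (bc_plus x) * bc_e2"
  by (simp add: bicomplex_eq_iff bc_of_complex_def bc_e1_def bc_e2_def bc_i1_def bc_i2_def
      bc_minus_def bc_plus_def field_simps)

abbreviation complex_linear_op :: "(complex^'n \<Rightarrow> complex^'n) \<Rightarrow> bool" where
  "complex_linear_op \<equiv> Vector_Spaces.linear (*s) (*s)"

(* The operator e_1 T_1 + e_2 T_2. The values of T_1 and T_2 are embedded into vectors
   over bicomplex before they are multiplied by e_1 and e_2. *)
definition e_sum ::
  "(complex^'n \<Rightarrow> complex^'n) \<Rightarrow> (complex^'n \<Rightarrow> complex^'n) \<Rightarrow> bicomplex^'n \<Rightarrow> bicomplex^'n" where
  "e_sum T1 T2 x =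
     bc_e1 *s (\<chi> i. bc_of_complex (T1 (\<chi> j. bc_minus (x $ j)) $ i)) +
     bc_e2 *s (\<chi> i. bc_of_complex (T2 (\<chi> j. bc_plus (x $ j)) $ i))"

definition e_product_ops :: "(bicomplex^'n \<Rightarrow> bicomplex^'n) set" where
  "e_product_ops = {e_sum T1 T2 |T1 T2. complex_linear_op T1 \<and> complex_linear_op T2}"

definition C2_idempotent :: "(bicomplex^'n \<Rightarrow> bicomplex^'n) \<Rightarrow> bool" where
  "C2_idempotent T \<longleftrightarrow> T \<in> e_product_ops \<and> T \<circ> T = T"

end

theory Submission
  imports Defs
begin

text \<open>The idempotent components of a vector identify the space of bicomplex vectors with a
  product of two copies of the space of complex vectors, and \<open>e_sum T1 T2\<close> is the
  product map of \<open>T1\<close> and \<open>T2\<close> in these coordinates. So \<open>e_sum\<close> is injective and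
  compatible with composition.\<close>

definition vec_minus :: "bicomplex^'n \<Rightarrow> complex^'n" where
  "vec_minus x = (\<chi> j. bc_minus (x $ j))"

definition vec_plus :: "bicomplex^'n \<Rightarrow> complex^'n" where
  "vec_plus x = (\<chi> j. bc_plus (x $ j))"

text \<open>\<open>bc_minus\<close> sends \<open>bc_e1\<close> to 1 and \<open>bc_e2\<close> to 0;
  for \<open>bc_plus\<close> the roles are swapped.\<close>

lemma bc_minus_combination:
  "bc_minus (bc_e1 * bc_of_complex a + bc_e2 * bc_of_complex b) = a"
  by (simp add: bc_minus_def bc_e1_def bc_e2_def bc_i1_def bc_i2_def bc_of_complex_def
      field_simps)

lemma bc_plus_combination:
  "bc_plus (bc_e1 * bc_of_complex a + bc_e2 * bc_of_complex b) = b"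
  by (simp add: bc_plus_def bc_e1_def bc_e2_def bc_i1_def bc_i2_def bc_of_complex_def
      field_simps)

lemma vec_minus_e_sum [simp]: "vec_minus (e_sum T1 T2 x) = T1 (vec_minus x)"
  by (simp add: vec_minus_def e_sum_def bc_minus_combination vec_eq_iff)

lemma vec_plus_e_sum [simp]: "vec_plus (e_sum T1 T2 x) = T2 (vec_plus x)"
  by (simp add: vec_plus_def e_sum_def bc_plus_combination vec_eq_iff)

text \<open>By \<open>bc_idempotent_decomp\<close> each entry is rebuilt from its two components.
  This serves as extensionality for values of \<open>e_sum\<close>.\<close>

lemma bicomplex_vec_eq_iff: "x = y \<longleftrightarrow> vec_minus x = vec_minus y \<and> vec_plus x = vec_plus y"
proof
  assume "vec_minus x = vec_minus y \<and> vec_plus x = vec_plus y"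
  then have "bc_minus (x $ j) = bc_minus (y $ j)" "bc_plus (x $ j) = bc_plus (y $ j)" for j
    by (simp_all add: vec_minus_def vec_plus_def vec_eq_iff)
  then show "x = y"
    unfolding vec_eq_iff by (metis bc_idempotent_decomp)
qed simp

lemma e_sum_comp: "e_sum S1 S2 \<circ> e_sum T1 T2 = e_sum (S1 \<circ> T1) (S2 \<circ> T2)"
  by (simp add: fun_eq_iff bicomplex_vec_eq_iff)

lemma e_sum_eq_iff: "e_sum S1 S2 = e_sum T1 T2 \<longleftrightarrow> S1 = T1 \<and> S2 = T2"
proof
  assume eq: "e_sum S1 S2 = e_sum T1 T2"
  have "S1 a = T1 a \<and> S2 a = T2 a" for a
  proof -
    \<comment> \<open>Constant maps yield a vector with both components equal to \<open>a\<close>,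
      whatever the argument; \<open>eq\<close> is then evaluated there.\<close>
    define x where "x = e_sum (\<lambda>_. a) (\<lambda>_. a) 0"
    have "vec_minus x = a" "vec_plus x = a"
      by (simp_all add: x_def)
    then show ?thesis
      by (metis eq vec_minus_e_sum vec_plus_e_sum)
  qed
  then show "S1 = T1 \<and> S2 = T2"
    by auto
qed simp

theorem theorem4p3:
  fixes T1 T2 :: "complex^'n \<Rightarrow> complex^'n"
  assumes "complex_linear_op T1" and "complex_linear_op T2"
  shows "C2_idempotent (e_sum T1 T2) \<longleftrightarrow> T1 \<circ> T1 = T1 \<and> T2 \<circ> T2 = T2"
proof -
  \<comment> \<open>Linearity settles the membership conjunct of \<open>C2_idempotent\<close>; the
    equation for the square is left.\<close>
  have "e_sum T1 T2 \<in> e_product_ops"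
    using assms by (auto simp: e_product_ops_def)
  then show ?thesis
    by (simp add: C2_idempotent_def e_sum_comp e_sum_eq_iff)
qed

end
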